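(* Let $D\colon \mathbf{N}^*\to\mathbf{N}$ be a function which vanishes identically on the complement of a finite set. Let $\mathbf{k}$ be an uncountable, algebraically closed field. There exist a birational transformation $h\colon \mathbb{P}^2_{\mathbf{k}}\dashrightarrow\mathbb{P}^2_{\mathbf{k}}$ and an integer $d\geq 1$ such that $$\deg(h^n)=d-D(n)\quad\text{for all } n\geq 1.$$ When $\mathbf{k}$ has characteristic $0$, one may find $h$ in $\mathrm{Bir}(\mathbb{P}^2_{\overline{\mathbf{Q}}})$.
   Context: $\mathbf{N}$ is the set of non-negative integers and $\mathbf{N}^*$ the set of positive integers. $\mathrm{Bir}(\mathbb{P}^2_K)$ is the group of birational transformations of $\mathbb{P}^2_K$. The degree $\deg(h)$ is the common degree of homogeneous polynomials without common factor defining $h$, and $h^n$ is the $n$-th iterate. *)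

theory Defs
  imports
    "HOL-Library.Poly_Mapping"
    "HOL-Library.Numeral_Type"
    "HOL-Library.Countable_Set"
    "HOL-Computational_Algebra.Computational_Algebra"
    "HOL-Algebra.Group"
begin

text \<open>
  Polynomials in three variables, indexed by the three-element type \<open>3\<close>. Exponent vectors are
  finitely supported functions on \<open>3\<close>, so the ring structure is that of \<open>Poly_Mapping\<close>.
\<close>

type_synonym 'k poly3 = "(3 \<Rightarrow>\<^sub>0 nat) \<Rightarrow>\<^sub>0 'k"

definition const3 :: "'k::zero \<Rightarrow> 'k poly3" where
  "const3 c = Poly_Mapping.single 0 c"

definition var3 :: "3 \<Rightarrow> 'k::zero_neq_one poly3" where
  "var3 i = Poly_Mapping.single (Poly_Mapping.single i 1) 1"

definition homogeneous3 :: "nat \<Rightarrow> 'k::zero poly3 \<Rightarrow> bool" where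
  "homogeneous3 d p \<longleftrightarrow>
     (\<forall>m \<in> Poly_Mapping.keys p. (\<Sum>i\<in>UNIV. Poly_Mapping.lookup m i) = d)"

definition subst3 :: "'k::comm_ring_1 poly3 \<Rightarrow> (3 \<Rightarrow> 'k poly3) \<Rightarrow> 'k poly3" where
  "subst3 p g = (\<Sum>m\<in>Poly_Mapping.keys p.
     const3 (Poly_Mapping.lookup p m) * (\<Prod>i\<in>UNIV. g i ^ Poly_Mapping.lookup m i))"

definition coeffs_in :: "'k::zero set \<Rightarrow> (3 \<Rightarrow> 'k poly3) \<Rightarrow> bool" where
  "coeffs_in F f \<longleftrightarrow> (\<forall>i m. Poly_Mapping.lookup (f i) m \<in> F)"

text \<open>
  A triple \<open>f\<close> stands for \<open>[x\<^sub>0 : x\<^sub>1 : x\<^sub>2] \<mapsto> [f\<^sub>0(x) : f\<^sub>1(x) : f\<^sub>2(x)]\<close>; its components may have a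
  common factor. A rational map of the plane to itself is a class of such triples modulo
  proportionality.
\<close>

definition form_triple :: "nat \<Rightarrow> (3 \<Rightarrow> 'k::zero poly3) \<Rightarrow> bool" where
  "form_triple d f \<longleftrightarrow> (\<forall>i. homogeneous3 d (f i)) \<and> (\<exists>i. f i \<noteq> 0)"

definition ratmap_rel :: "((3 \<Rightarrow> 'k::comm_ring_1 poly3) \<times> (3 \<Rightarrow> 'k poly3)) set" where
  "ratmap_rel = {(f, g). (\<exists>d. form_triple d f) \<and> (\<exists>e. form_triple e g) \<and>
     (\<forall>i j. f i * g j = f j * g i)}"

definition ratmaps :: "(3 \<Rightarrow> 'k::comm_ring_1 poly3) set set" where
  "ratmaps = {f. \<exists>d. form_triple d f} // ratmap_rel"

text \<open>
  The zero triple is related to nothing, so \<open>ratmap_comp A B\<close> is the class of \<open>A \<circ> B\<close> if that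
  composition of rational maps is defined, and \<open>{}\<close> (which is not a rational map) if the image
  of \<open>B\<close> lies in the indeterminacy locus of \<open>A\<close>.
\<close>

definition ratmap_comp ::
  "(3 \<Rightarrow> 'k::comm_ring_1 poly3) set \<Rightarrow> (3 \<Rightarrow> 'k poly3) set \<Rightarrow> (3 \<Rightarrow> 'k poly3) set" where
  "ratmap_comp A B = (\<Union>f\<in>A. \<Union>g\<in>B. ratmap_rel `` {\<lambda>i. subst3 (f i) g})"

definition ratmap_id :: "(3 \<Rightarrow> 'k::comm_ring_1 poly3) set" where
  "ratmap_id = ratmap_rel `` {var3}"

definition defined_over :: "'k::comm_ring_1 set \<Rightarrow> (3 \<Rightarrow> 'k poly3) set \<Rightarrow> bool" where
  "defined_over F A \<longleftrightarrow> (\<exists>f\<in>A. coeffs_in F f)"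

text \<open>
  For a subfield \<open>F\<close> of the ground field \<open>k\<close>, \<open>Bir F\<close> is the group of birational transformations
  of the projective plane over \<open>F\<close>, realised inside that over \<open>k\<close>; the latter is \<open>Bir UNIV\<close>.
\<close>

definition Bir :: "'k::field set \<Rightarrow> (3 \<Rightarrow> 'k poly3) set monoid" where
  "Bir F = \<lparr>carrier = {A \<in> ratmaps. defined_over F A \<and>
                (\<exists>B\<in>ratmaps. defined_over F B \<and>
                   ratmap_comp A B = ratmap_id \<and> ratmap_comp B A = ratmap_id)},
            mult = ratmap_comp, one = ratmap_id\<rparr>"

definition ratmap_degree :: "(3 \<Rightarrow> 'k::field poly3) set \<Rightarrow> nat" where
  "ratmap_degree A = (THE d. \<exists>f\<in>A. form_triple d f \<and>
     (\<forall>c. (\<forall>i. c dvd f i) \<longrightarrow> c dvd 1))"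

text \<open>
  In characteristic zero this is the algebraic closure of the rationals in \<open>'k\<close>. It is the
  defining property of the constant \<open>algebraic\<close>, which is only available on \<open>field_char_0\<close>.
\<close>

definition Qbar :: "'k::field set" where
  "Qbar = {x. \<exists>p. (\<forall>i. coeff p i \<in> \<int>) \<and> p \<noteq> 0 \<and> poly p x = 0}"

end

theory Submission
  imports Defs
begin

text \<open>
  The maps are conjugates of the scaling \<open>(x, y) \<mapsto> (\<alpha> x, y)\<close> of the affine plane, where \<open>\<alpha>\<close> has
  infinite multiplicative order. Let \<open>P\<close> be the monic polynomial in one variable whose roots are
  the elements of a finite set \<open>S\<close>, all simple. Conjugation by \<open>(x, y) \<mapsto> (x, y P(x))\<close> turns the
  scaling by \<open>a\<close> into \<open>h\<^sub>a : (x, y) \<mapsto> (a x, y P(a x) / P(x))\<close>. Thus \<open>a \<mapsto> h\<^sub>a\<close> is a homomorphism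
  from the multiplicative group, and the \<open>n\<close>-th iterate of \<open>h = h\<^sub>\<alpha>\<close> is \<open>h\<^sub>a\<close> with \<open>a = \<alpha>\<^sup>n\<close>
  (\<open>ratmap_comp_twist_map\<close>, \<open>twist_map_power\<close>).

  The degree of \<open>h\<^sub>a\<close> is \<open>1 + \<bar>S\<bar>\<close> minus the number of roots that cancel in \<open>P(a x) / P(x)\<close>,
  that is, the number of \<open>z \<in> S\<close> with \<open>a z \<in> S\<close> (\<open>ratmap_degree_twist_map\<close>). It remains to choose
  \<open>S\<close> so that exactly \<open>D(n)\<close> of its elements \<open>z\<close> satisfy \<open>\<alpha>\<^sup>n z \<in> S\<close>, for every \<open>n \<ge> 1\<close>. The set
  \<open>S\<close> is made of pairs \<open>c, \<alpha>\<^sup>n c\<close>, with \<open>D(n)\<close> pairs for each \<open>n\<close>, all of them in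
  different orbits under multiplication by \<open>\<alpha>\<close> (\<open>exists_set_with_coincidences\<close>). Then
  \<open>d = 1 + \<bar>S\<bar>\<close>. Enough orbits exist over an uncountable field because an orbit is countable. In
  characteristic zero \<open>\<alpha> = 2\<close> and odd integers \<open>c\<close> will do, and \<open>h\<close> is even defined over the
  rationals.

  The degree of a rational map is read off a triple without common factor. All factors that
  occur in the argument are products of linear forms \<open>X - z Z\<close>. Such a form is prime, being
  the generator of the kernel of the substitution \<open>X := z Z\<close> (\<open>lin3_dvd_iff\<close>), and Euclid's
  argument with these primes takes the place of unique factorisation: every triple proportional
  to the reduced triple of \<open>h\<^sub>a\<close> is a polynomial multiple of it (\<open>ratmap_degree_fibred\<close>).
\<close>

section \<open>Evaluation of ternary polynomials\<close>

lemma UNIV_3_eq: "(UNIV :: 3 set) = {0, 1, 2}"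
proof -
  have "card {0, 1, 2 :: 3} = card (UNIV :: 3 set)"
    by simp
  thus ?thesis
    by (metis card_subset_eq finite subset_UNIV)
qed

lemma all_3_iff: "(\<forall>i :: 3. P i) \<longleftrightarrow> P 0 \<and> P 1 \<and> P 2"
proof -
  have "i = 0 \<or> i = 1 \<or> i = 2" for i :: 3
    using UNIV_3_eq by blast
  thus ?thesis
    by metis
qed

lemma prod_UNIV_3: "(\<Prod>i\<in>(UNIV :: 3 set). f i) = f 0 * (f 1 * f 2)"
  unfolding UNIV_3_eq by simp

lemma poly_mapping_sum_single:
  "p = (\<Sum>m\<in>Poly_Mapping.keys p. Poly_Mapping.single m (Poly_Mapping.lookup p m))"
  by (rule poly_mapping_eqI) (auto simp: lookup_sum lookup_single when_def sum.delta in_keys_iff)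

lemma poly3_induct [case_names zero single add]:
  assumes "P 0" "\<And>m c. P (Poly_Mapping.single m c)" "\<And>p q. P p \<Longrightarrow> P q \<Longrightarrow> P (p + q)"
  shows "P (p :: 'k::comm_monoid_add poly3)"
proof -
  have "P (\<Sum>m\<in>A. Poly_Mapping.single m (Poly_Mapping.lookup p m))" if "finite A" for A
    using that by (induction A rule: finite_induct) (auto intro: assms)
  thus ?thesis
    by (subst poly_mapping_sum_single) simp
qed

text \<open>
  Substituting polynomials for the variables, and grading a polynomial by an extra indeterminate,
  are both evaluations along a homomorphism on the coefficients. They are treated together.
\<close>

locale coeff_hom =
  fixes \<phi> :: "'k::comm_ring_1 \<Rightarrow> 'a::comm_ring_1"
  assumes hom_0 [simp]: "\<phi> 0 = 0" and hom_1 [simp]: "\<phi> 1 = 1"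
    and hom_add: "\<phi> (x + y) = \<phi> x + \<phi> y" and hom_mult: "\<phi> (x * y) = \<phi> x * \<phi> y"
begin

definition eval3 :: "(3 \<Rightarrow> 'a) \<Rightarrow> 'k poly3 \<Rightarrow> 'a" where
  "eval3 g p = (\<Sum>m\<in>Poly_Mapping.keys p.
     \<phi> (Poly_Mapping.lookup p m) * (\<Prod>i\<in>UNIV. g i ^ Poly_Mapping.lookup m i))"

lemma eval3_superset:
  assumes "finite A" "Poly_Mapping.keys p \<subseteq> A"
  shows "eval3 g p =
    (\<Sum>m\<in>A. \<phi> (Poly_Mapping.lookup p m) * (\<Prod>i\<in>UNIV. g i ^ Poly_Mapping.lookup m i))"
  unfolding eval3_def using assms by (intro sum.mono_neutral_left) (auto simp: in_keys_iff)

lemma eval3_single: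
  "eval3 g (Poly_Mapping.single m c) = \<phi> c * (\<Prod>i\<in>UNIV. g i ^ Poly_Mapping.lookup m i)"
  by (subst eval3_superset[where A = "{m}"]) auto

lemma eval3_0 [simp]: "eval3 g 0 = 0"
  by (simp add: eval3_def)

lemma eval3_add: "eval3 g (p + q) = eval3 g p + eval3 g q"
proof -
  let ?A = "Poly_Mapping.keys p \<union> Poly_Mapping.keys q"
  have "Poly_Mapping.keys (p + q) \<subseteq> ?A"
    by (rule keys_add)
  thus ?thesis
    by (simp add: eval3_superset[of ?A] lookup_add hom_add distrib_right sum.distrib)
qed

lemma eval3_mult: "eval3 g (p * q) = eval3 g p * eval3 g q"
proof (induction p rule: poly3_induct)
  case (single m c)
  show ?case
  proof (induction q rule: poly3_induct)
    case (single m' c')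
    show ?case
      by (simp add: mult_single eval3_single hom_mult lookup_add power_add prod.distrib)
  qed (simp_all add: distrib_left eval3_add)
qed (simp_all add: distrib_right eval3_add)

lemma eval3_1 [simp]: "eval3 g 1 = 1"
  by (subst single_one[symmetric], subst eval3_single) simp

lemma eval3_uminus: "eval3 g (- p) = - eval3 g p"
  using eval3_add[of g p "- p"] by (simp add: eq_neg_iff_add_eq_0 add.commute)

lemma eval3_diff: "eval3 g (p - q) = eval3 g p - eval3 g q"
  using eval3_add[of g p "- q"] by (simp add: eval3_uminus)

lemma eval3_prod: "eval3 g (\<Prod>x\<in>A. f x) = (\<Prod>x\<in>A. eval3 g (f x))"
  by (induction A rule: infinite_finite_induct) (simp_all add: eval3_mult)

lemma eval3_const [simp]: "eval3 g (const3 c) = \<phi> c"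
  by (simp add: const3_def eval3_single)

lemma eval3_var [simp]: "eval3 g (var3 i) = g i"
proof -
  have "(\<Prod>j\<in>UNIV. g j ^ Poly_Mapping.lookup (Poly_Mapping.single i (1 :: nat)) j) =
        (\<Prod>j\<in>UNIV. if i = j then g j else 1)"
    by (intro prod.cong) (auto simp: lookup_single when_def)
  thus ?thesis
    by (simp add: var3_def eval3_single)
qed

lemma eval3_scale:
  assumes "homogeneous3 d p"
  shows "eval3 (\<lambda>i. t * g i) p = t ^ d * eval3 g p"
proof -
  have "(\<Prod>i\<in>UNIV. (t * g i) ^ Poly_Mapping.lookup m i) =
        t ^ d * (\<Prod>i\<in>UNIV. g i ^ Poly_Mapping.lookup m i)" if "m \<in> Poly_Mapping.keys p" for m
    using assms that
    by (simp add: homogeneous3_def power_mult_distrib prod.distrib power_sum[symmetric])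
  thus ?thesis
    unfolding eval3_def sum_distrib_left by (intro sum.cong) (simp_all add: mult_ac)
qed

end

lemma const3_mult: "const3 (x * y) = const3 x * const3 y"
  by (simp add: const3_def mult_single)

interpretation subst: coeff_hom "const3 :: 'k::comm_ring_1 \<Rightarrow> 'k poly3"
  rewrites "coeff_hom.eval3 const3 = (\<lambda>g p. subst3 p g)"
proof -
  show "coeff_hom (const3 :: 'k \<Rightarrow> 'k poly3)"
    by standard (simp_all add: const3_def single_add mult_single)
  then interpret coeff_hom "const3 :: 'k \<Rightarrow> 'k poly3" .
  show "eval3 = (\<lambda>g p. subst3 p g)"
    by (simp add: eval3_def subst3_def fun_eq_iff)
qed

lemma const3_eq_0_iff [simp]: "const3 c = 0 \<longleftrightarrow> c = 0"
  unfolding const3_def by (metis inj_single injD single_zero)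

lemma var3_neq_0 [simp]: "(var3 i :: 'k::zero_neq_one poly3) \<noteq> 0"
  unfolding var3_def by (metis inj_single injD single_zero zero_neq_one)

lemma const3_power: "const3 (x ^ n) = (const3 x :: 'k::comm_ring_1 poly3) ^ n"
  by (induction n) (simp_all add: const3_mult)

lemma single_eq_monomial:
  "Poly_Mapping.single m c = const3 c * (\<Prod>i\<in>UNIV. var3 i ^ Poly_Mapping.lookup m i)"
  for c :: "'k::comm_ring_1"
proof -
  have var_power: "var3 i ^ n = (Poly_Mapping.single (Poly_Mapping.single i n) 1 :: 'k poly3)" for i n
    by (induction n) (simp_all add: var3_def mult_single single_add[symmetric])
  have "m = Poly_Mapping.single 0 (Poly_Mapping.lookup m 0) +
            (Poly_Mapping.single 1 (Poly_Mapping.lookup m 1) +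
             Poly_Mapping.single 2 (Poly_Mapping.lookup m 2))"
  proof (rule poly_mapping_eqI)
    fix k :: 3
    have "k = 0 \<or> k = 1 \<or> k = 2"
      using UNIV_3_eq by blast
    thus "Poly_Mapping.lookup m k = Poly_Mapping.lookup
            (Poly_Mapping.single 0 (Poly_Mapping.lookup m 0) +
            (Poly_Mapping.single 1 (Poly_Mapping.lookup m 1) +
             Poly_Mapping.single 2 (Poly_Mapping.lookup m 2))) k"
      by (auto simp: lookup_add lookup_single)
  qed
  thus ?thesis
    by (simp add: prod_UNIV_3 var_power const3_def mult_single)
qed

lemma subst3_var3 [simp]: "subst3 p var3 = p" for p :: "'k::comm_ring_1 poly3"
proof (induction p rule: poly3_induct)
  case (single m c)
  show ?case
    by (simp add: subst.eval3_single single_eq_monomial[symmetric])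
qed (simp_all add: subst.eval3_add)


section \<open>Homogeneous polynomials\<close>

lemma homogeneous3_0 [simp]: "homogeneous3 d 0"
  by (simp add: homogeneous3_def)

lemma homogeneous3_const [simp]: "homogeneous3 0 (const3 c)"
  by (simp add: homogeneous3_def const3_def)

lemma homogeneous3_1 [simp]: "homogeneous3 0 1"
  by (simp add: homogeneous3_def)

lemma homogeneous3_var [simp]: "homogeneous3 1 (var3 i)"
proof -
  have "(\<Sum>j\<in>UNIV. Poly_Mapping.lookup (Poly_Mapping.single i (1 :: nat)) j) =
        (\<Sum>j\<in>UNIV. if i = j then 1 else 0)"
    by (intro sum.cong) (auto simp: lookup_single when_def)
  thus ?thesis
    by (simp add: homogeneous3_def var3_def)
qed

lemma homogeneous3_add: "homogeneous3 d p \<Longrightarrow> homogeneous3 d q \<Longrightarrow> homogeneous3 d (p + q)"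
  using keys_add[of p q] unfolding homogeneous3_def by blast

lemma homogeneous3_diff:
  "homogeneous3 d p \<Longrightarrow> homogeneous3 d q \<Longrightarrow> homogeneous3 d (p - q)"
  for p q :: "'k::ab_group_add poly3"
  unfolding homogeneous3_def by (metis diff_zero in_keys_iff lookup_minus)

lemma homogeneous3_mult:
  assumes "homogeneous3 d p" "homogeneous3 e q"
  shows "homogeneous3 (d + e) (p * q)"
  unfolding homogeneous3_def
proof
  fix m assume "m \<in> Poly_Mapping.keys (p * q)"
  then obtain a b where "m = a + b" "a \<in> Poly_Mapping.keys p" "b \<in> Poly_Mapping.keys q"
    using keys_mult[of p q] by blast
  thus "(\<Sum>i\<in>UNIV. Poly_Mapping.lookup m i) = d + e"
    using assms by (simp add: homogeneous3_def lookup_add sum.distrib)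
qed

lemma homogeneous3_prod:
  assumes "\<And>x. x \<in> A \<Longrightarrow> homogeneous3 (d x) (f x)"
  shows "homogeneous3 (\<Sum>x\<in>A. d x) (\<Prod>x\<in>A. f x :: 'k::comm_ring_1 poly3)"
  using assms
  by (induction A rule: infinite_finite_induct) (auto intro: homogeneous3_mult)

lemma homogeneous3_power:
  "homogeneous3 d p \<Longrightarrow> homogeneous3 (n * d) (p ^ n)" for p :: "'k::comm_ring_1 poly3"
  by (induction n) (auto intro: homogeneous3_mult)

lemma homogeneous3_subst:
  assumes "homogeneous3 d p" "\<And>i. homogeneous3 e (g i)"
  shows "homogeneous3 (d * e) (subst3 p g)"
proof -
  have monomial: "homogeneous3 (d * e)
    (const3 (Poly_Mapping.lookup p m) * (\<Prod>i\<in>UNIV. g i ^ Poly_Mapping.lookup m i))"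
    if "m \<in> Poly_Mapping.keys p" for m
  proof -
    have "homogeneous3 (0 + (\<Sum>i\<in>UNIV. Poly_Mapping.lookup m i * e))
       (const3 (Poly_Mapping.lookup p m) * (\<Prod>i\<in>UNIV. g i ^ Poly_Mapping.lookup m i))"
      by (intro homogeneous3_mult homogeneous3_prod homogeneous3_power homogeneous3_const assms)
    moreover have "(\<Sum>i\<in>UNIV. Poly_Mapping.lookup m i * e) = d * e"
      using assms(1) that by (simp add: homogeneous3_def sum_distrib_right[symmetric])
    ultimately show ?thesis
      by simp
  qed
  have "homogeneous3 (d * e) (\<Sum>m\<in>A. const3 (Poly_Mapping.lookup p m) *
          (\<Prod>i\<in>UNIV. g i ^ Poly_Mapping.lookup m i))"
    if "finite A" "A \<subseteq> Poly_Mapping.keys p" for A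
    using that by (induction A rule: finite_induct) (auto intro: homogeneous3_add monomial)
  thus ?thesis
    by (simp add: subst3_def)
qed

text \<open>
  With each variable \<open>x\<^sub>i\<close> replaced by \<open>T x\<^sub>i\<close>, a form \<open>p\<close> of degree \<open>d\<close> becomes \<open>p T\<^sup>d\<close>. This
  homomorphism to polynomials in \<open>T\<close> reads off the degree, and sends units to constants.
\<close>

interpretation grade: coeff_hom "\<lambda>c :: 'k::comm_ring_1. [:const3 c:] :: 'k poly3 poly"
  by standard (simp_all add: subst.hom_add const3_mult one_pCons)

lemma grade_homogeneous:
  fixes p :: "'k::comm_ring_1 poly3"
  assumes "homogeneous3 d p"
  shows "grade.eval3 (\<lambda>i. [:0, 1:] * [:var3 i:]) p = monom p d"
proof -
  have pow: "[:q:] ^ n = [:q ^ n:]" for q :: "'k poly3" and n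
    by (induction n) (simp_all add: one_pCons)
  have "grade.eval3 (\<lambda>i. [:var3 i:]) p = [:subst3 p var3:]"
  proof (induction p rule: poly3_induct)
    case (single m c)
    show ?case
      by (subst grade.eval3_single) (simp add: prod_UNIV_3 pow single_eq_monomial)
  qed (simp_all add: grade.eval3_add)
  hence "grade.eval3 (\<lambda>i. [:0, 1:] * [:var3 i:]) p = [:0, 1:] ^ d * [:p:]"
    by (simp only: grade.eval3_scale[OF assms] subst3_var3)
  also have "\<dots> = monom p d"
    by (simp add: monom_altdef mult.commute)
  finally show ?thesis .
qed

lemma homogeneous3_degree_unit_multiple:
  fixes p v :: "'k::field poly3"
  assumes "homogeneous3 d p" "homogeneous3 e (v * p)" "p \<noteq> 0" "v dvd 1"
  shows "e = d"
proof -
  define G where "G = grade.eval3 (\<lambda>i. [:0, 1:] * [:var3 i :: 'k poly3:])"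
  obtain w where w: "1 = v * w"
    using assms(4) by (auto elim: dvdE)
  have "G v * G w = 1"
    by (simp add: G_def grade.eval3_mult[symmetric] w[symmetric])
  hence "G v \<noteq> 0" "G w \<noteq> 0" "degree (G v * G w) = 0"
    by auto
  hence "G v \<noteq> 0" "degree (G v) = 0"
    by (auto simp: degree_mult_eq)
  moreover have "G v * monom p d = monom (v * p) e"
    using grade_homogeneous[OF assms(1)] grade_homogeneous[OF assms(2)]
    by (simp add: G_def grade.eval3_mult)
  moreover have "v \<noteq> 0"
    using assms(4) by auto
  ultimately show ?thesis
    using assms(3) degree_mult_eq[of "G v" "monom p d"] by (auto simp: degree_monom_eq)
qed


section \<open>Rational maps as classes of triples\<close>

lemma ratmap_rel_refl: "form_triple d f \<Longrightarrow> (f, f) \<in> ratmap_rel"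
  by (auto simp: ratmap_rel_def mult.commute)

lemma ratmap_rel_sym: "(f, g) \<in> ratmap_rel \<Longrightarrow> (g, f) \<in> ratmap_rel"
  by (auto simp: ratmap_rel_def) (metis mult.commute)

lemma ratmap_rel_trans:
  fixes f g h :: "3 \<Rightarrow> 'k::field poly3"
  assumes fg: "(f, g) \<in> ratmap_rel" and gh: "(g, h) \<in> ratmap_rel"
  shows "(f, h) \<in> ratmap_rel"
proof -
  obtain k where k: "g k \<noteq> 0"
    using fg by (auto simp: ratmap_rel_def form_triple_def)
  have "f i * h j = f j * h i" for i j
  proof -
    have "g k * (f i * h j) = f i * (g j * h k)"
      using gh by (simp add: ratmap_rel_def mult_ac)
    also have "\<dots> = f j * (g i * h k)"
      using fg by (simp add: ratmap_rel_def mult.assoc[symmetric])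
    also have "\<dots> = g k * (f j * h i)"
      using gh by (simp add: ratmap_rel_def mult_ac)
    finally show ?thesis
      using k by simp
  qed
  thus ?thesis
    using fg gh by (auto simp: ratmap_rel_def)
qed

lemma ratmap_class_eqI:
  "(f, g) \<in> ratmap_rel \<Longrightarrow> ratmap_rel `` {f} = ratmap_rel `` {g :: 3 \<Rightarrow> 'k::field poly3}"
  by (auto intro: ratmap_rel_trans ratmap_rel_sym)

lemma ratmap_class_multiple:
  fixes f g :: "3 \<Rightarrow> 'k::field poly3"
  assumes "form_triple d f" "form_triple e g" "\<And>i. g i = c * f i"
  shows "ratmap_rel `` {g} = ratmap_rel `` {f}"
  using assms by (intro ratmap_class_eqI) (auto simp: ratmap_rel_def mult_ac)

text \<open>
  The composition does not depend on the representatives: if \<open>u g' = w g\<close>, then homogeneity gives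
  \<open>u\<^sup>d f\<^sub>i(g') = w\<^sup>d f\<^sub>i(g)\<close>. Representatives whose substitution vanishes contribute nothing to the
  union.
\<close>

lemma ratmap_comp_class:
  fixes f g :: "3 \<Rightarrow> 'k::field poly3"
  assumes f: "form_triple d f" and g: "form_triple e g" and nz: "subst3 (f l) g \<noteq> 0"
  shows "ratmap_comp (ratmap_rel `` {f}) (ratmap_rel `` {g}) = ratmap_rel `` {\<lambda>i. subst3 (f i) g}"
    (is "_ = ratmap_rel `` {?h}")
proof (rule antisym)
  show "ratmap_rel `` {?h} \<subseteq> ratmap_comp (ratmap_rel `` {f}) (ratmap_rel `` {g})"
    using ratmap_rel_refl[OF f] ratmap_rel_refl[OF g] by (auto simp: ratmap_comp_def)
next
  have h: "form_triple (d * e) ?h"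
    using f g nz by (auto simp: form_triple_def intro: homogeneous3_subst)
  have "(?h, k) \<in> ratmap_rel"
    if f': "(f, f') \<in> ratmap_rel" and g': "(g, g') \<in> ratmap_rel"
      and k: "(\<lambda>i. subst3 (f' i) g', k) \<in> ratmap_rel" for f' g' k
  proof -
    let ?h' = "\<lambda>i. subst3 (f' i) g'"
    obtain n where n: "g n \<noteq> 0"
      using g by (auto simp: form_triple_def)
    define u w where "u = g n" and "w = g' n"
    have uw: "u * g' j = w * g j" for j
      using g' by (simp add: ratmap_rel_def u_def w_def mult.commute)
    have "w \<noteq> 0"
    proof
      assume "w = 0"
      hence "g' j = 0" for j
        using uw[of j] n by (simp add: u_def)
      thus False
        using g' by (auto simp: ratmap_rel_def form_triple_def)
    qed
    have scale: "w ^ d * ?h i = u ^ d * subst3 (f i) g'" for i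
    proof -
      have "homogeneous3 d (f i)"
        using f by (simp add: form_triple_def)
      from subst.eval3_scale[OF this, of w g] subst.eval3_scale[OF this, of u g']
      show ?thesis
        by (simp add: uw)
    qed
    have ff': "subst3 (f i) g' * ?h' j = subst3 (f j) g' * ?h' i" for i j
      using f' by (simp add: ratmap_rel_def subst.eval3_mult[symmetric])
    have "?h i * ?h' j = ?h j * ?h' i" for i j
    proof -
      have "w ^ d * (?h i * ?h' j) = u ^ d * (subst3 (f i) g' * ?h' j)"
        by (simp add: mult.assoc[symmetric] scale)
      also have "\<dots> = u ^ d * (subst3 (f j) g' * ?h' i)"
        by (simp only: ff')
      also have "\<dots> = w ^ d * (?h j * ?h' i)"
        by (simp add: mult.assoc[symmetric] scale)
      finally show ?thesis
        using \<open>w \<noteq> 0\<close> by simp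
    qed
    hence "(?h, ?h') \<in> ratmap_rel"
      using h k by (auto simp: ratmap_rel_def)
    thus ?thesis
      using k by (rule ratmap_rel_trans)
  qed
  thus "ratmap_comp (ratmap_rel `` {f}) (ratmap_rel `` {g}) \<subseteq> ratmap_rel `` {?h}"
    by (auto simp: ratmap_comp_def)
qed

text \<open>
  If every triple proportional to \<open>f\<close> is a multiple of \<open>f\<close>, then \<open>f\<close> has no common factor, and any
  other triple without common factor differs from \<open>f\<close> by a unit, hence has the same degree.
\<close>

lemma ratmap_degree_class:
  fixes f :: "3 \<Rightarrow> 'k::field poly3"
  assumes f: "form_triple d f"
    and gen: "\<And>g. (\<And>i j. f i * g j = f j * g i) \<Longrightarrow> \<exists>v. \<forall>i. g i = v * f i"
  shows "ratmap_degree (ratmap_rel `` {f}) = d"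
proof -
  obtain l where l: "f l \<noteq> 0"
    using f by (auto simp: form_triple_def)
  have coprime: "c dvd 1" if c: "\<forall>i. c dvd f i" for c
  proof -
    from c obtain g where g: "\<And>i. f i = c * g i"
      unfolding dvd_def by metis
    have "f i * g j = f j * g i" for i j
      by (simp add: g mult_ac)
    then obtain v where "\<And>i. g i = v * f i"
      using gen by blast
    hence "f l = (c * v) * f l"
      using g by (metis mult.assoc)
    hence "c * v = 1"
      using l by simp
    thus ?thesis
      by (metis dvd_triv_left)
  qed
  show ?thesis
    unfolding ratmap_degree_def
  proof (rule the_equality)
    show "\<exists>g\<in>ratmap_rel `` {f}. form_triple d g \<and> (\<forall>c. (\<forall>i. c dvd g i) \<longrightarrow> c dvd 1)"
      using f coprime ratmap_rel_refl[OF f] by blast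
  next
    fix e
    assume "\<exists>g\<in>ratmap_rel `` {f}. form_triple e g \<and> (\<forall>c. (\<forall>i. c dvd g i) \<longrightarrow> c dvd 1)"
    then obtain g where g: "(f, g) \<in> ratmap_rel" "form_triple e g"
      "\<And>c. (\<forall>i. c dvd g i) \<Longrightarrow> c dvd 1"
      by auto
    obtain v where v: "\<And>i. g i = v * f i"
      using gen[of g] g(1) by (auto simp: ratmap_rel_def)
    hence "v dvd 1"
      using g(3) by simp
    moreover have "homogeneous3 d (f l)" "homogeneous3 e (v * f l)"
      using f g(2) v[symmetric] by (simp_all add: form_triple_def)
    ultimately show "e = d"
      using homogeneous3_degree_unit_multiple l by blast
  qed
qed


section \<open>Divisibility by linear forms through a coordinate point\<close>

definition lin3 :: "'k::comm_ring_1 \<Rightarrow> 'k poly3" where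
  "lin3 z = var3 0 - const3 z * var3 2"

definition on_line :: "'k::comm_ring_1 \<Rightarrow> 3 \<Rightarrow> 'k poly3" where
  "on_line z i = (if i = 0 then const3 z * var3 2 else var3 i)"

lemma lin3_dvd_diff_subst: "lin3 z dvd p - subst3 p (on_line z)"
proof (induction p rule: poly3_induct)
  case (single m c)
  let ?a = "Poly_Mapping.lookup m 0"
  let ?R = "const3 c * (var3 1 ^ Poly_Mapping.lookup m 1 * var3 2 ^ Poly_Mapping.lookup m 2)"
  have "lin3 z dvd var3 0 ^ ?a - (const3 z * var3 2) ^ ?a"
    unfolding lin3_def power_diff_sumr2 by simp
  hence "lin3 z dvd ?R * (var3 0 ^ ?a - (const3 z * var3 2) ^ ?a)"
    by (rule dvd_mult)
  also have "\<dots> = Poly_Mapping.single m c - subst3 (Poly_Mapping.single m c) (on_line z)"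
    by (subst single_eq_monomial, subst subst.eval3_single)
       (simp add: prod_UNIV_3 on_line_def algebra_simps)
  finally show ?case .
next
  case (add p q)
  thus ?case
    using dvd_add[OF add] by (simp add: subst.eval3_add algebra_simps)
qed simp

text \<open>
  The form \<open>X - z Z\<close> generates the kernel of the substitution \<open>X := z Z\<close>, whose target is an
  integral domain; hence it is prime.
\<close>

lemma lin3_dvd_iff: "lin3 z dvd p \<longleftrightarrow> subst3 p (on_line z) = 0"
proof
  assume "lin3 z dvd p"
  then obtain q where "p = lin3 z * q"
    by (elim dvdE)
  thus "subst3 p (on_line z) = 0"
    by (simp add: subst.eval3_mult subst.eval3_diff lin3_def on_line_def)
next
  assume "subst3 p (on_line z) = 0"
  thus "lin3 z dvd p"
    using lin3_dvd_diff_subst[of z p] by simp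
qed

lemma lin3_neq_0 [simp]: "lin3 z \<noteq> (0 :: 'k::field poly3)"
proof
  assume "lin3 z = 0"
  hence "subst3 (lin3 z) (on_line (z + 1)) = 0"
    by simp
  hence "const3 1 * var3 2 = (0 :: 'k poly3)"
    by (simp add: lin3_def subst.eval3_mult subst.eval3_diff on_line_def subst.hom_add
        algebra_simps)
  thus False
    by simp
qed

lemma prime_elem_lin3: "prime_elem (lin3 z :: 'k::field poly3)"
  by (rule prime_elemI) (auto simp: lin3_neq_0 lin3_dvd_iff subst.eval3_mult)

lemma lin3_not_dvd_var: "i \<noteq> 0 \<Longrightarrow> \<not> lin3 z dvd (var3 i :: 'k::field poly3)"
  by (simp add: lin3_dvd_iff on_line_def)

lemma lin3_not_dvd_const: "c \<noteq> 0 \<Longrightarrow> \<not> lin3 z dvd (const3 c :: 'k::field poly3)"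
  by (simp add: lin3_dvd_iff)

lemma lin3_dvd_lin3_iff: "lin3 z dvd lin3 w \<longleftrightarrow> z = (w :: 'k::field)"
proof -
  have "subst3 (lin3 w) (on_line z) = const3 (z - w) * var3 2"
    using subst.hom_add[of "z - w" w]
    by (simp add: lin3_def subst.eval3_mult subst.eval3_diff on_line_def algebra_simps)
  thus ?thesis
    by (simp add: lin3_dvd_iff)
qed

lemma lin3_dvd_prod_iff:
  "finite T \<Longrightarrow> lin3 z dvd (\<Prod>w\<in>T. lin3 w) \<longleftrightarrow> z \<in> (T :: 'k::field set)"
  by (induction T rule: finite_induct)
     (use prime_elem_lin3[of z] in
       \<open>auto simp: prime_elem_dvd_mult_iff lin3_dvd_lin3_iff dest: prime_elem_not_unit\<close>)

text \<open>Euclid's lemma, one prime factor at a time.\<close>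

lemma prod_lin3_dvd_cancel:
  fixes u N :: "'k::field poly3"
  assumes "finite U" "\<And>z. z \<in> U \<Longrightarrow> \<not> lin3 z dvd N" "(\<Prod>z\<in>U. lin3 z) dvd u * N"
  shows "(\<Prod>z\<in>U. lin3 z) dvd u"
  using assms
proof (induction U arbitrary: u rule: finite_induct)
  case (insert z U)
  have "lin3 z dvd u * N"
    using insert.hyps insert.prems(2) by (auto intro: dvd_mult_left)
  hence "lin3 z dvd u"
    using insert.prems(1) by (auto simp: prime_elem_dvd_mult_iff[OF prime_elem_lin3])
  then obtain u' where u': "u = lin3 z * u'"
    by (elim dvdE)
  have "(\<Prod>z\<in>U. lin3 z) dvd u' * N"
    using insert.hyps insert.prems(2) by (simp add: u' mult.assoc)
  hence "(\<Prod>z\<in>U. lin3 z) dvd u'"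
    using insert.IH insert.prems(1) by blast
  thus ?case
    using insert.hyps by (simp add: u' mult_dvd_mono)
qed simp

lemma prod_lin3_neq_0: "(\<Prod>z\<in>U. lin3 z) \<noteq> (0 :: 'k::field poly3)"
  by (induction U rule: infinite_finite_induct) (simp_all add: lin3_neq_0)

lemma homogeneous3_lin3: "homogeneous3 1 (lin3 z :: 'k::comm_ring_1 poly3)"
  unfolding lin3_def
  using homogeneous3_mult[OF homogeneous3_const homogeneous3_var, of z 2]
  by (intro homogeneous3_diff) (simp_all del: One_nat_def)

lemma homogeneous3_prod_lin3:
  "homogeneous3 (card U) (\<Prod>z\<in>U. lin3 z :: 'k::comm_ring_1 poly3)"
proof -
  have "homogeneous3 (\<Sum>z\<in>U. 1) (\<Prod>z\<in>U. lin3 z :: 'k poly3)"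
    by (intro homogeneous3_prod homogeneous3_lin3)
  thus ?thesis
    by simp
qed

text \<open>
  In affine coordinates this is \<open>(x, y) \<mapsto> (a x, y R(x))\<close>, where \<open>R\<close> is a rational function in lowest
  terms with numerator and denominator of equal degree. The prime factors of the denominator
  divide neither \<open>Y\<close> nor the numerator, so the homogeneous triple is reduced and its degree is one
  more than the degree of \<open>R\<close>.
\<close>

lemma ratmap_degree_fibred:
  fixes a b :: "'k::field" and T U :: "'k set"
  defines "f \<equiv> \<lambda>i :: 3. if i = 0 then const3 a * var3 0 * (\<Prod>z\<in>U. lin3 z)
      else if i = 1 then const3 b * var3 1 * (\<Prod>z\<in>T. lin3 z) else var3 2 * (\<Prod>z\<in>U. lin3 z)"
  assumes ab: "a \<noteq> 0" "b \<noteq> 0" and fin: "finite T" "finite U"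
    and disj: "T \<inter> U = {}" and card: "card T = card U"
  shows "form_triple (card U + 1) f" "ratmap_degree (ratmap_rel `` {f}) = card U + 1"
proof -
  define PT where "PT = (\<Prod>z\<in>T. lin3 z)"
  define PU where "PU = (\<Prod>z\<in>U. lin3 z)"
  have f: "f 0 = const3 a * var3 0 * PU" "f 1 = const3 b * var3 1 * PT" "f 2 = var3 2 * PU"
    by (simp_all add: f_def PT_def PU_def)
  have nz: "PT \<noteq> 0" "PU \<noteq> 0"
    by (simp_all add: PT_def PU_def prod_lin3_neq_0)
  have hom: "homogeneous3 (card U) PT" "homogeneous3 (card U) PU"
    using homogeneous3_prod_lin3[of T] homogeneous3_prod_lin3[of U]
    by (simp_all add: PT_def PU_def card)
  have "homogeneous3 (0 + 1 + card U) (f 0)" "homogeneous3 (0 + 1 + card U) (f 1)"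
    "homogeneous3 (1 + card U) (f 2)"
    unfolding f by (intro homogeneous3_mult homogeneous3_const homogeneous3_var hom)+
  moreover have "f 2 \<noteq> 0"
    using nz by (simp add: f)
  ultimately show form: "form_triple (card U + 1) f"
    unfolding form_triple_def by (auto simp: all_3_iff)
  show "ratmap_degree (ratmap_rel `` {f}) = card U + 1"
  proof (rule ratmap_degree_class[OF form])
    fix g assume g: "\<And>i j. f i * g j = f j * g i"
    (* The first and last components of f have the ratio a X : Z, so X divides g 0. *)
    have X: "lin3 0 = (var3 0 :: 'k poly3)"
      by (simp add: lin3_def)
    have "PU * (const3 a * var3 0 * g 2) = PU * (var3 2 * g 0)"
      using g[of 0 2] by (simp add: f mult_ac)
    hence XZ: "const3 a * var3 0 * g 2 = var3 2 * g 0"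
      using nz by simp
    hence "lin3 0 dvd var3 2 * g 0"
      unfolding X by (metis dvd_triv_left mult.assoc mult.commute)
    hence "lin3 0 dvd g 0"
      by (simp add: prime_elem_dvd_mult_iff[OF prime_elem_lin3] lin3_not_dvd_var)
    then obtain u' where u': "g 0 = var3 0 * u'"
      by (auto simp: X elim: dvdE)
    define u where "u = const3 (1 / a) * u'"
    have "const3 a * u = u'"
      using ab by (simp add: u_def mult.assoc[symmetric] const3_mult[symmetric])
    hence g0: "g 0 = const3 a * var3 0 * u"
      unfolding u' by (metis mult.assoc mult.commute)
    have "const3 a * var3 0 * g 2 = const3 a * var3 0 * (var3 2 * u)"
      using XZ by (simp add: g0 mult_ac)
    hence g2: "g 2 = var3 2 * u"
      using ab by simp
    have "var3 2 * (u * (const3 b * var3 1 * PT)) = var3 2 * (PU * g 1)"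
      using g[of 1 2] by (simp add: f g2 mult_ac)
    hence YU: "u * (const3 b * var3 1 * PT) = PU * g 1"
      by simp
    have "PU dvd u"
    proof -
      have "\<not> lin3 z dvd const3 b * var3 1 * PT" if "z \<in> U" for z
        using that ab disj fin lin3_not_dvd_var[of 1 z] lin3_not_dvd_const[of b z]
          lin3_dvd_prod_iff[of T z]
        by (auto simp: prime_elem_dvd_mult_iff[OF prime_elem_lin3] PT_def)
      thus ?thesis
        using fin YU prod_lin3_dvd_cancel[of U "const3 b * var3 1 * PT" u]
        by (simp add: PU_def)
    qed
    then obtain v where v: "u = PU * v"
      by (elim dvdE)
    have "PU * g 1 = PU * (const3 b * var3 1 * PT * v)"
      using YU[symmetric] by (simp add: v mult_ac)
    hence "g 1 = v * f 1"
      using nz by (simp add: f mult_ac)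
    moreover have "g 0 = v * f 0" "g 2 = v * f 2"
      by (simp_all add: g0 g2 v f mult_ac)
    ultimately show "\<exists>v. \<forall>i. g i = v * f i"
      by (auto simp: all_3_iff)
  qed
qed


section \<open>A one-parameter group of birational maps\<close>

text \<open>
  The product over \<open>z \<in> S\<close> of \<open>a X - z Z\<close> is the homogenisation of \<open>P(a x)\<close>, where \<open>P\<close> is the
  monic polynomial with the simple roots \<open>S\<close>. In affine coordinates \<open>twist_map S a\<close> is
  \<open>(x, y) \<mapsto> (a x, y P(a x) / P(x))\<close>, the conjugate of \<open>(x, y) \<mapsto> (a x, y)\<close> by
  \<open>(x, y) \<mapsto> (x, y P(x))\<close>.
\<close>

definition scaled_form :: "'k::field set \<Rightarrow> 'k \<Rightarrow> 'k poly3" where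
  "scaled_form S a = (\<Prod>z\<in>S. const3 a * var3 0 - const3 z * var3 2)"

definition twist_map :: "'k::field set \<Rightarrow> 'k \<Rightarrow> 3 \<Rightarrow> 'k poly3" where
  "twist_map S a i =
     (if i = 0 then const3 a * var3 0 * scaled_form S 1
      else if i = 1 then var3 1 * scaled_form S a
      else var3 2 * scaled_form S 1)"

lemma twist_map_simps:
  "twist_map S a 0 = const3 a * var3 0 * scaled_form S 1"
  "twist_map S a 1 = var3 1 * scaled_form S a"
  "twist_map S a 2 = var3 2 * scaled_form S 1"
  by (simp_all add: twist_map_def)

lemma scaled_form_eq_prod_lin3:
  assumes "a \<noteq> 0"
  shows "scaled_form S a = const3 (a ^ card S) * (\<Prod>z\<in>(\<lambda>z. z / a) ` S. lin3 z)"
proof -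
  have "scaled_form S a = (\<Prod>z\<in>S. const3 a * lin3 (z / a))"
    unfolding scaled_form_def
    by (intro prod.cong refl)
       (simp add: assms lin3_def right_diff_distrib mult.assoc[symmetric] const3_mult[symmetric])
  also have "\<dots> = const3 (a ^ card S) * (\<Prod>z\<in>S. lin3 (z / a))"
    by (simp add: prod.distrib const3_power)
  also have "(\<Prod>z\<in>S. lin3 (z / a)) = (\<Prod>z\<in>(\<lambda>z. z / a) ` S. lin3 z)"
    using assms by (subst prod.reindex) (auto intro: inj_onI)
  finally show ?thesis .
qed

lemma scaled_form_neq_0: "a \<noteq> 0 \<Longrightarrow> scaled_form S a \<noteq> 0"
  by (simp add: scaled_form_eq_prod_lin3 prod_lin3_neq_0)

lemma form_triple_twist_map:
  assumes "a \<noteq> 0"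
  shows "form_triple (card S + 1) (twist_map S a)"
proof -
  have "homogeneous3 (0 + 1) (const3 a * var3 0 - const3 z * var3 2)" for a z :: 'a
    by (intro homogeneous3_diff homogeneous3_mult homogeneous3_const homogeneous3_var)
  hence "homogeneous3 (card S) (scaled_form S a)" for a
    using homogeneous3_prod[of S "\<lambda>_. 1" "\<lambda>z. const3 a * var3 0 - const3 z * var3 2"]
    by (simp add: scaled_form_def)
  hence "homogeneous3 (0 + 1 + card S) (twist_map S a 0)"
    "homogeneous3 (1 + card S) (twist_map S a 1)" "homogeneous3 (1 + card S) (twist_map S a 2)"
    unfolding twist_map_simps
    by (intro homogeneous3_mult homogeneous3_const homogeneous3_var; assumption)+
  moreover have "twist_map S a 2 \<noteq> 0"
    by (simp add: twist_map_simps scaled_form_neq_0)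
  ultimately show ?thesis
    unfolding form_triple_def by (auto simp: all_3_iff)
qed

lemma subst3_scaled_form:
  "subst3 (scaled_form S a) (twist_map S b) = scaled_form S 1 ^ card S * scaled_form S (a * b)"
proof -
  have "subst3 (scaled_form S a) (twist_map S b) =
    (\<Prod>z\<in>S. scaled_form S 1 * (const3 (a * b) * var3 0 - const3 z * var3 2))"
    unfolding scaled_form_def[of S a] subst.eval3_prod
    by (intro prod.cong refl)
       (simp add: subst.eval3_diff subst.eval3_mult twist_map_simps const3_mult algebra_simps)
  thus ?thesis
    by (simp add: prod.distrib scaled_form_def[of S "a * b"])
qed

lemma subst3_twist_map:
  "subst3 (twist_map S a i) (twist_map S b) =
     scaled_form S 1 ^ card S * scaled_form S b * twist_map S (a * b) i"
proof -
  have "\<forall>i. subst3 (twist_map S a i) (twist_map S b) =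
     scaled_form S 1 ^ card S * scaled_form S b * twist_map S (a * b) i"
    unfolding all_3_iff twist_map_simps
    by (simp add: subst.eval3_mult subst3_scaled_form twist_map_simps const3_mult mult_ac)
  thus ?thesis ..
qed

lemma ratmap_comp_twist_map:
  assumes "a \<noteq> 0" "b \<noteq> 0"
  shows "ratmap_comp (ratmap_rel `` {twist_map S a}) (ratmap_rel `` {twist_map S b}) =
    ratmap_rel `` {twist_map S (a * b)}"
proof -
  let ?h = "\<lambda>i. subst3 (twist_map S a i) (twist_map S b)"
  note forms = form_triple_twist_map[OF assms(1), of S] form_triple_twist_map[OF assms(2), of S]
  have nz: "?h 2 \<noteq> 0"
    unfolding subst3_twist_map using assms by (simp add: twist_map_simps scaled_form_neq_0)
  have "ratmap_comp (ratmap_rel `` {twist_map S a}) (ratmap_rel `` {twist_map S b}) =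
    ratmap_rel `` {?h}"
    by (rule ratmap_comp_class[OF forms nz])
  also have "\<dots> = ratmap_rel `` {twist_map S (a * b)}"
  proof (rule ratmap_class_multiple)
    show "form_triple (card S + 1) (twist_map S (a * b))"
      using assms by (intro form_triple_twist_map) simp
    show "form_triple ((card S + 1) * (card S + 1)) ?h"
      using forms nz unfolding form_triple_def by (blast intro: homogeneous3_subst)
  qed (rule subst3_twist_map)
  finally show ?thesis .
qed

lemma ratmap_id_eq_twist_map: "ratmap_id = ratmap_rel `` {twist_map S 1}"
proof -
  have "form_triple 1 (var3 :: 3 \<Rightarrow> 'a poly3)"
    by (simp add: form_triple_def del: One_nat_def)
  moreover have "\<forall>i. twist_map S 1 i = scaled_form S 1 * var3 i"
    unfolding all_3_iff twist_map_simps
    by (simp add: const3_def mult.commute)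
  ultimately show ?thesis
    unfolding ratmap_id_def
    using ratmap_class_multiple[OF _ form_triple_twist_map[of 1 S]] by fastforce
qed

text \<open>
  The rational function \<open>P(a x) / P(x)\<close> has zeros \<open>S / a\<close> and poles \<open>S\<close>; the common points are
  the \<open>z \<in> S\<close> with \<open>a z \<in> S\<close>, and each of them lowers the degree by one.
\<close>

lemma ratmap_degree_twist_map:
  fixes S :: "'k::field set"
  assumes a: "a \<noteq> 0" and S: "finite S"
  shows "ratmap_degree (ratmap_rel `` {twist_map S a}) + card {z \<in> S. a * z \<in> S} = card S + 1"
proof -
  define S' where "S' = (\<lambda>z. z / a) ` S"
  define T U where "T = S' - S" and "U = S - S'"
  define C where "C = (\<Prod>z\<in>S \<inter> S'. lin3 z)"
  define f where "f = (\<lambda>i :: 3. if i = 0 then const3 a * var3 0 * (\<Prod>z\<in>U. lin3 z)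
      else if i = 1 then const3 (a ^ card S) * var3 1 * (\<Prod>z\<in>T. lin3 z)
      else var3 2 * (\<Prod>z\<in>U. lin3 z))"
  have "card S' = card S"
    unfolding S'_def using a by (intro card_image) (auto intro: inj_onI)
  have fin: "finite S'" "finite T" "finite U"
    using S by (simp_all add: S'_def T_def U_def)
  have split: "card (S \<inter> S') + card U = card S" "card (S \<inter> S') + card T = card S'"
    using S fin by (simp_all add: U_def T_def card_Diff_subset_Int Int_commute card_mono)
  have common: "S \<inter> S' = {z \<in> S. a * z \<in> S}"
    using a by (force simp: S'_def image_iff)
  have f: "form_triple (card U + 1) f" "ratmap_degree (ratmap_rel `` {f}) = card U + 1"
    unfolding f_def using a fin split \<open>card S' = card S\<close>
    by (intro ratmap_degree_fibred; auto simp: T_def U_def)+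
  have "(\<Prod>z\<in>S. lin3 z) = C * (\<Prod>z\<in>U. lin3 z)"
    unfolding C_def U_def using S
    by (subst prod.union_disjoint[symmetric]) (auto intro: prod.cong)
  hence P: "scaled_form S 1 = C * (\<Prod>z\<in>U. lin3 z)"
    by (simp add: scaled_form_eq_prod_lin3 const3_def)
  have "(\<Prod>z\<in>S'. lin3 z) = C * (\<Prod>z\<in>T. lin3 z)"
    unfolding C_def T_def using S fin
    by (subst prod.union_disjoint[symmetric]) (auto intro: prod.cong)
  hence Pa: "scaled_form S a = const3 (a ^ card S) * (C * (\<Prod>z\<in>T. lin3 z))"
    using a by (simp add: scaled_form_eq_prod_lin3 S'_def[symmetric])
  have "\<forall>i. twist_map S a i = C * f i"
    unfolding all_3_iff twist_map_simps P Pa by (simp add: f_def mult_ac)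
  hence "ratmap_rel `` {twist_map S a} = ratmap_rel `` {f}"
    using ratmap_class_multiple[OF f(1) form_triple_twist_map[OF a]] by blast
  thus ?thesis
    using f(2) split common by simp
qed


section \<open>Fields of definition\<close>

definition subring_set :: "'k::comm_ring_1 set \<Rightarrow> bool" where
  "subring_set K \<longleftrightarrow> 1 \<in> K \<and> (\<forall>x\<in>K. \<forall>y\<in>K. x - y \<in> K \<and> x * y \<in> K)"

lemma subring_setD:
  assumes "subring_set K"
  shows "1 \<in> K" "0 \<in> K" "x \<in> K \<Longrightarrow> y \<in> K \<Longrightarrow> x - y \<in> K" "x \<in> K \<Longrightarrow> y \<in> K \<Longrightarrow> x * y \<in> K"
    "x \<in> K \<Longrightarrow> y \<in> K \<Longrightarrow> x + y \<in> K"
proof -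
  have one: "1 \<in> K" and diff: "\<And>x y. x \<in> K \<Longrightarrow> y \<in> K \<Longrightarrow> x - y \<in> K"
    and mult: "\<And>x y. x \<in> K \<Longrightarrow> y \<in> K \<Longrightarrow> x * y \<in> K"
    using assms by (auto simp: subring_set_def)
  show "1 \<in> K" "x \<in> K \<Longrightarrow> y \<in> K \<Longrightarrow> x - y \<in> K" "x \<in> K \<Longrightarrow> y \<in> K \<Longrightarrow> x * y \<in> K"
    by (fact one diff mult)+
  show zero: "0 \<in> K"
    using diff[OF one one] by simp
  show "x + y \<in> K" if "x \<in> K" "y \<in> K"
    using diff[OF that(1) diff[OF zero that(2)]] by simp
qed

definition poly3_over :: "'k::comm_ring_1 set \<Rightarrow> 'k poly3 set" where
  "poly3_over K = {p. \<forall>m. Poly_Mapping.lookup p m \<in> K}"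

lemma sum_in_subring_set:
  assumes "subring_set K" "\<And>x. x \<in> A \<Longrightarrow> f x \<in> K"
  shows "sum f A \<in> K"
  using assms(2)
  by (induction A rule: infinite_finite_induct) (auto intro: subring_setD[OF assms(1)])

lemma subring_set_poly3_over:
  assumes K: "subring_set K"
  shows "subring_set (poly3_over K)"
proof -
  have "Poly_Mapping.lookup (p * q) m \<in> K" if p: "p \<in> poly3_over K" and q: "q \<in> poly3_over K" for p q m
  proof -
    have "p * q = (\<Sum>a\<in>Poly_Mapping.keys p. \<Sum>b\<in>Poly_Mapping.keys q. Poly_Mapping.single (a + b)
            (Poly_Mapping.lookup p a * Poly_Mapping.lookup q b))"
      by (subst (1) poly_mapping_sum_single[of p], subst (1) poly_mapping_sum_single[of q])
         (simp add: sum_product mult_single)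
    also have "Poly_Mapping.lookup \<dots> m \<in> K"
      unfolding lookup_sum lookup_single when_def using p q
      by (intro sum_in_subring_set[OF K]) (auto simp: poly3_over_def intro: subring_setD[OF K])
    finally show ?thesis .
  qed
  thus ?thesis
    by (auto simp: subring_set_def poly3_over_def lookup_minus lookup_one when_def
        intro: subring_setD[OF K])
qed

lemma coeffs_in_twist_map:
  assumes K: "subring_set K" and a: "a \<in> K" and S: "S \<subseteq> K"
  shows "coeffs_in K (twist_map S a)"
proof -
  note poly = subring_setD[OF subring_set_poly3_over[OF K]]
  have const: "const3 c \<in> poly3_over K" if "c \<in> K" for c
    using that subring_setD[OF K] by (auto simp: poly3_over_def const3_def lookup_single when_def)
  have var: "var3 i \<in> poly3_over K" for i
    using subring_setD[OF K] by (auto simp: poly3_over_def var3_def lookup_single when_def)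
  have "scaled_form A b \<in> poly3_over K" if "b \<in> K" "A \<subseteq> K" for A b
    unfolding scaled_form_def using that(2)
    by (induction A rule: infinite_finite_induct)
       (auto intro!: poly(1,3,4) const var that(1))
  hence "\<forall>i. twist_map S a i \<in> poly3_over K"
    unfolding all_3_iff twist_map_simps using a S
    by (auto intro!: poly(4) const var subring_setD(1)[OF K])
  thus ?thesis
    by (simp add: coeffs_in_def poly3_over_def)
qed

lemma twist_map_in_Bir:
  fixes S :: "'k::field set"
  assumes K: "subring_set K" "K \<subseteq> F" and a: "a \<in> K" "inverse a \<in> K" "a \<noteq> 0" and S: "S \<subseteq> K"
  shows "ratmap_rel `` {twist_map S a} \<in> carrier (Bir F)"
proof -
  have cls: "ratmap_rel `` {twist_map S b} \<in> ratmaps \<and> defined_over F (ratmap_rel `` {twist_map S b})"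
    if b: "b \<in> K" "b \<noteq> 0" for b
  proof
    note form = form_triple_twist_map[OF b(2), of S]
    show "ratmap_rel `` {twist_map S b} \<in> ratmaps"
      using form by (auto simp: ratmaps_def intro: quotientI)
    have "coeffs_in F (twist_map S b)"
      using coeffs_in_twist_map[OF K(1) b(1) S] K(2) by (auto simp: coeffs_in_def)
    thus "defined_over F (ratmap_rel `` {twist_map S b})"
      using ratmap_rel_refl[OF form] by (auto simp: defined_over_def)
  qed
  (* The inverse map is the twist by the inverse of a, since the twists form a group. *)
  have "inverse a \<noteq> 0"
    using a by simp
  thus ?thesis
    using cls[OF a(1,3)] cls[OF a(2)] ratmap_comp_twist_map[of a "inverse a" S]
      ratmap_comp_twist_map[of "inverse a" a S] ratmap_id_eq_twist_map[of S] a(3)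
    by (auto simp: Bir_def)
qed

lemma twist_map_power:
  assumes "a \<noteq> 0"
  shows "(ratmap_rel `` {twist_map S a}) [^]\<^bsub>Bir F\<^esub> (n :: nat) = ratmap_rel `` {twist_map S (a ^ n)}"
proof (induction n)
  case 0
  show ?case
    by (simp add: nat_pow_def Bir_def ratmap_id_eq_twist_map[of S])
next
  case (Suc n)
  have "(ratmap_rel `` {twist_map S a}) [^]\<^bsub>Bir F\<^esub> Suc n =
    ratmap_comp ((ratmap_rel `` {twist_map S a}) [^]\<^bsub>Bir F\<^esub> n) (ratmap_rel `` {twist_map S a})"
    by (simp add: nat_pow_def Bir_def)
  thus ?case
    using assms by (simp add: Suc ratmap_comp_twist_map mult.commute)
qed


section \<open>Prescribing the coincidences along orbits\<close>

text \<open>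
  Reserve one orbit \<open>c\<^sub>j, c\<^sub>j \<alpha>, c\<^sub>j \<alpha>\<^sup>2, \<dots>\<close> for every unit of \<open>D\<close>, and for a unit of \<open>D(n)\<close>
  put the two points \<open>c\<^sub>j\<close> and \<open>c\<^sub>j \<alpha>\<^sup>n\<close> of that orbit into \<open>S\<close>. Points of distinct orbits never
  meet, so \<open>z\<close> and \<open>\<alpha>\<^sup>m z\<close> both lie in \<open>S\<close> for exactly \<open>D(m)\<close> points \<open>z\<close>.
\<close>

lemma exists_set_with_coincidences:
  fixes D :: "nat \<Rightarrow> nat" and \<alpha> :: "'k::field" and c :: "nat \<Rightarrow> 'k"
  assumes D: "finite {n. n \<ge> 1 \<and> D n \<noteq> 0}" and inj: "inj (\<lambda>(j, k). c j * \<alpha> ^ k)"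
  shows "\<exists>S. finite S \<and> S \<subseteq> {c j * \<alpha> ^ k | j k. True} \<and>
    (\<forall>m\<ge>1. card {z \<in> S. \<alpha> ^ m * z \<in> S} = D m)"
proof -
  (* The i-th unit of D n gets the orbit with number prod_encode (n, i); k is the position in it. *)
  define p where "p n i k = c (prod_encode (n, i)) * \<alpha> ^ k" for n i k
  have p_eq: "p n i k = p n' i' k' \<longleftrightarrow> n = n' \<and> i = i' \<and> k = k'" for n i k n' i' k'
  proof
    assume "p n i k = p n' i' k'"
    thus "n = n' \<and> i = i' \<and> k = k'"
      using injD[OF inj, of "(prod_encode (n, i), k)" "(prod_encode (n', i'), k')"]
      by (simp add: p_def)
  qed simp
  have shift: "\<alpha> ^ m * p n i k = p n i (k + m)" for m n i k
    by (simp add: p_def power_add mult_ac)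
  define I where "I = (SIGMA n:{n. n \<ge> 1 \<and> D n \<noteq> 0}. {..<D n})"
  define S where "S = (\<lambda>(n, i). p n i 0) ` I \<union> (\<lambda>(n, i). p n i n) ` I"
  have S_iff: "z \<in> S \<longleftrightarrow> (\<exists>n i. n \<ge> 1 \<and> i < D n \<and> (z = p n i 0 \<or> z = p n i n))" for z
    by (auto simp: S_def I_def image_iff Bex_def)
  have "finite S"
    using D by (simp add: S_def I_def)
  moreover have "S \<subseteq> {c j * \<alpha> ^ k | j k. True}"
  proof
    fix z assume "z \<in> S"
    then obtain n i k where "z = p n i k"
      by (auto simp: S_iff)
    thus "z \<in> {c j * \<alpha> ^ k | j k. True}"
      unfolding p_def by blast
  qed
  moreover have "card {z \<in> S. \<alpha> ^ m * z \<in> S} = D m" if "m \<ge> 1" for m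
  proof -
    have "{z \<in> S. \<alpha> ^ m * z \<in> S} = (\<lambda>i. p m i 0) ` {..<D m}"
    proof (intro equalityI subsetI)
      fix z assume "z \<in> {z \<in> S. \<alpha> ^ m * z \<in> S}"
      then obtain n i k where z: "z = p n i k" "i < D n" "k = 0 \<or> k = n" "p n i (k + m) \<in> S"
        by (auto simp: S_iff[of z] shift)
      hence "k = 0 \<and> n = m"
        using that by (auto simp: S_iff p_eq)
      thus "z \<in> (\<lambda>i. p m i 0) ` {..<D m}"
        using z by auto
    next
      fix z assume "z \<in> (\<lambda>i. p m i 0) ` {..<D m}"
      thus "z \<in> {z \<in> S. \<alpha> ^ m * z \<in> S}"
        using that by (auto simp: S_iff p_eq shift)
    qed
    thus ?thesis
      by (simp add: card_image inj_on_def p_eq)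
  qed
  ultimately show ?thesis
    by blast
qed

lemma exists_Bir_with_degrees:
  fixes D :: "nat \<Rightarrow> nat" and \<alpha> :: "'k::field" and c :: "nat \<Rightarrow> 'k"
  assumes D: "finite {n. n \<ge> 1 \<and> D n \<noteq> 0}" and inj: "inj (\<lambda>(j, k). c j * \<alpha> ^ k)"
    and K: "subring_set K" "K \<subseteq> F" "\<alpha> \<in> K" "inverse \<alpha> \<in> K" "\<And>j. c j \<in> K"
  shows "\<exists>h \<in> carrier (Bir F). \<exists>d::int. d \<ge> 1 \<and>
     (\<forall>n::nat. n \<ge> 1 \<longrightarrow> int (ratmap_degree (h [^]\<^bsub>Bir F\<^esub> n)) = d - int (D n))"
proof -
  obtain S where S: "finite S" "S \<subseteq> {c j * \<alpha> ^ k | j k. True}"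
    "\<And>m. m \<ge> 1 \<Longrightarrow> card {z \<in> S. \<alpha> ^ m * z \<in> S} = D m"
    using exists_set_with_coincidences[OF D inj] by blast
  have "\<alpha> \<noteq> 0"
    using injD[OF inj, of "(0, 1)" "(0, 2)"] by auto
  have "\<alpha> ^ k \<in> K" for k
    by (induction k) (auto intro: subring_setD[OF K(1)] K)
  hence "S \<subseteq> K"
    using S(2) K(5) subring_setD(4)[OF K(1)] by blast
  show ?thesis
  proof (intro bexI exI conjI allI impI)
    show "ratmap_rel `` {twist_map S \<alpha>} \<in> carrier (Bir F)"
      using K \<open>\<alpha> \<noteq> 0\<close> \<open>S \<subseteq> K\<close> by (intro twist_map_in_Bir)
    show "int (card S + 1) \<ge> 1"
      by simp
    fix n :: nat assume "n \<ge> 1"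
    thus "int (ratmap_degree ((ratmap_rel `` {twist_map S \<alpha>}) [^]\<^bsub>Bir F\<^esub> n)) =
        int (card S + 1) - int (D n)"
      using ratmap_degree_twist_map[of "\<alpha> ^ n" S] S(1) S(3)[of n] \<open>\<alpha> \<noteq> 0\<close>
      by (simp add: twist_map_power)
  qed
qed


section \<open>Infinitely many orbits\<close>

text \<open>
  There are only countably many roots of unity, which leaves room for \<open>\<alpha>\<close>. The orbits of \<open>\<alpha>\<close> are
  countable and cover the field, so there are infinitely many of them.
\<close>

lemma exists_disjoint_orbits_uncountable:
  assumes unc: "uncountable (UNIV :: 'k::field set)"
  shows "\<exists>(\<alpha> :: 'k) c. inj (\<lambda>(j :: nat, k :: nat). c j * \<alpha> ^ k)"
proof -
  have "finite {x :: 'k. x ^ Suc n = 1}" for n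
  proof -
    have "coeff (monom 1 (Suc n) - 1 :: 'k poly) 0 \<noteq> 0"
      by simp
    hence "monom 1 (Suc n) - 1 \<noteq> (0 :: 'k poly)"
      by (metis coeff_0)
    from poly_roots_finite[OF this] show ?thesis
      by (simp add: poly_monom)
  qed
  hence "countable (insert 0 (\<Union>n. {x :: 'k. x ^ Suc n = 1}))"
    by (auto intro: countable_finite)
  hence "insert 0 (\<Union>n. {x :: 'k. x ^ Suc n = 1}) \<noteq> UNIV"
    using unc by metis
  then obtain \<alpha> :: 'k where \<alpha>: "\<alpha> \<noteq> 0" "\<And>n. \<alpha> ^ Suc n \<noteq> 1"
    by blast
  have power_inj: "k = l" if "\<alpha> ^ k = \<alpha> ^ l" for k l
    using that
  proof (induction k l rule: linorder_wlog)
    case (le k l)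
    have "\<alpha> ^ k * \<alpha> ^ (l - k) = \<alpha> ^ l"
      using le(1) by (simp flip: power_add)
    also have "\<dots> = \<alpha> ^ k * 1"
      using le(2) by simp
    finally have "\<alpha> ^ (l - k) = 1"
      using \<alpha>(1) by simp
    hence "l - k = 0"
      using \<alpha>(2) by (cases "l - k") auto
    thus ?case
      using le by simp
  qed simp
  define orb where "orb x = {y. \<exists>k l. y * \<alpha> ^ l = x * \<alpha> ^ k}" for x
  have countable_orb: "countable (orb x)" for x
  proof -
    have "orb x \<subseteq> range (\<lambda>(k, l). x * \<alpha> ^ k / \<alpha> ^ l)"
    proof
      fix y assume "y \<in> orb x"
      then obtain k l where "y * \<alpha> ^ l = x * \<alpha> ^ k"
        by (auto simp: orb_def)
      hence "y = x * \<alpha> ^ k / \<alpha> ^ l"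
        using \<alpha>(1) by (simp add: field_simps)
      thus "y \<in> range (\<lambda>(k, l). x * \<alpha> ^ k / \<alpha> ^ l)"
        by force
    qed
    thus ?thesis
      by (rule countable_subset) simp
  qed
  have "infinite (orb ` (UNIV - {0}))"
  proof
    assume "finite (orb ` (UNIV - {0}))"
    hence "countable (\<Union>A\<in>orb ` (UNIV - {0}). A)"
      using countable_orb by (intro countable_UN[OF countable_finite]) auto
    moreover have "UNIV \<subseteq> insert 0 (\<Union>A\<in>orb ` (UNIV - {0}). A)"
      by (auto simp: orb_def)
    ultimately show False
      using unc by (meson countable_insert countable_subset)
  qed
  then obtain o' :: "nat \<Rightarrow> 'k set" where o': "inj o'" "range o' \<subseteq> orb ` (UNIV - {0})"
    using infinite_countable_subset by blast
  hence "\<forall>j. \<exists>x. x \<noteq> 0 \<and> o' j = orb x"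
    by blast
  then obtain c where c: "\<And>j. c j \<noteq> 0" "\<And>j. o' j = orb (c j)"
    by metis
  have orb_sub: "orb x \<subseteq> orb y" if "x * \<alpha> ^ k = y * \<alpha> ^ l" for x y k l
  proof
    fix w assume "w \<in> orb x"
    then obtain m n where "w * \<alpha> ^ n = x * \<alpha> ^ m"
      by (auto simp: orb_def)
    hence "w * \<alpha> ^ (n + k) = y * \<alpha> ^ (m + l)"
      using that by (simp add: power_add) (metis mult.assoc mult.commute)
    thus "w \<in> orb y"
      by (auto simp: orb_def)
  qed
  have "inj (\<lambda>(j :: nat, k :: nat). c j * \<alpha> ^ k)"
  proof (rule injI, clarify)
    fix i k j l assume eq: "c i * \<alpha> ^ k = c j * \<alpha> ^ l"
    hence "o' i = o' j"
      using orb_sub[OF eq] orb_sub[OF eq[symmetric]] c(2) by blast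
    hence "i = j"
      using o'(1) by (simp add: inj_eq)
    moreover have "k = l"
      using eq c(1)[of j] power_inj by (simp add: \<open>i = j\<close>)
    ultimately show "i = j \<and> k = l" ..
  qed
  thus ?thesis
    by blast
qed

lemma odd_times_power_2_inject:
  "(2 * i + 1) * 2 ^ k = (2 * j + 1) * (2 :: nat) ^ l \<Longrightarrow> i = j \<and> k = l"
proof (induction k arbitrary: l)
  case 0
  show ?case
  proof (cases l)
    case (Suc l')
    hence "even ((2 * i + 1) * 2 ^ 0 :: nat)"
      unfolding 0 by simp
    thus ?thesis
      by simp
  qed (use 0 in simp)
next
  case (Suc k)
  show ?case
  proof (cases l)
    case 0
    hence "even ((2 * j + 1) * 2 ^ 0 :: nat)"
      using Suc.prems by (metis even_mult_iff even_numeral even_power zero_less_Suc)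
    thus ?thesis
      by simp
  next
    case (Suc l')
    thus ?thesis
      using Suc.prems Suc.IH[of l'] by simp
  qed
qed

text \<open>
  The case \<open>\<alpha> = 2\<close>: a positive integer is an odd number times a power of 2 in only one way, and the
  integers embed into the field.
\<close>

lemma disjoint_orbits_CHAR_0:
  assumes "CHAR('k::field) = 0"
  shows "inj (\<lambda>(j :: nat, k :: nat). of_nat (2 * j + 1) * (2 :: 'k) ^ k)"
proof (rule injI, clarify)
  have of_nat_inj: "m = n" if "of_nat m = (of_nat n :: 'k)" for m n
    using that
  proof (induction m n rule: linorder_wlog)
    case (le m n)
    hence "of_nat (n - m) = (0 :: 'k)"
      by (simp add: of_nat_diff)
    hence "CHAR('k) dvd n - m"
      by (simp only: of_nat_eq_0_iff_char_dvd)
    thus ?case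
      using assms le(1) by simp
  qed simp
  fix i k j l
  assume "of_nat (2 * i + 1) * 2 ^ k = of_nat (2 * j + 1) * (2 :: 'k) ^ l"
  hence "(of_nat ((2 * i + 1) * 2 ^ k) :: 'k) = of_nat ((2 * j + 1) * 2 ^ l)"
    by (simp only: of_nat_mult of_nat_power of_nat_numeral)
  hence "(2 * i + 1) * 2 ^ k = (2 * j + 1) * 2 ^ l"
    by (rule of_nat_inj)
  thus "i = j \<and> k = l"
    by (rule odd_times_power_2_inject)
qed

text \<open>
  This is the prime field. Characteristic zero is a hypothesis on \<open>'k\<close> rather than part of its type,
  so the embedding \<open>of_rat\<close> of the rationals does not apply.
\<close>

definition int_fractions :: "'k::field set" where
  "int_fractions = {of_int m / of_int n | m n. (of_int n :: 'k) \<noteq> 0}"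

lemma int_fractionsI: "(of_int n :: 'k::field) \<noteq> 0 \<Longrightarrow> of_int m / of_int n \<in> (int_fractions :: 'k set)"
  by (auto simp: int_fractions_def)

lemma subring_set_int_fractions: "subring_set (int_fractions :: 'k::field set)"
  unfolding subring_set_def
proof (intro conjI ballI)
  show "1 \<in> (int_fractions :: 'k set)"
    using int_fractionsI[of 1 1] by simp
  fix x y :: 'k assume "x \<in> int_fractions" "y \<in> int_fractions"
  then obtain a b c d where xy: "x = of_int a / of_int b" "(of_int b :: 'k) \<noteq> 0"
      "y = of_int c / of_int d" "(of_int d :: 'k) \<noteq> 0"
    by (auto simp: int_fractions_def)
  have "x - y = of_int (a * d - c * b) / of_int (b * d)" "x * y = of_int (a * c) / of_int (b * d)"
    using xy(2,4) by (simp_all add: xy(1,3) diff_frac_eq)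
  moreover have "(of_int (b * d) :: 'k) \<noteq> 0"
    using xy by simp
  ultimately show "x - y \<in> int_fractions" "x * y \<in> int_fractions"
    using int_fractionsI by metis+
qed

lemma int_fractions_subset_Qbar: "(int_fractions :: 'k::field set) \<subseteq> Qbar"
proof
  fix x :: 'k assume "x \<in> int_fractions"
  then obtain m n where x: "x = of_int m / of_int n" "(of_int n :: 'k) \<noteq> 0"
    by (auto simp: int_fractions_def)
  let ?p = "[:- of_int m, of_int n:] :: 'k poly"
  have "\<forall>i. coeff ?p i \<in> \<int>"
    by (auto simp: coeff_pCons split: nat.split)
  moreover have "?p \<noteq> 0" "poly ?p x = 0"
    using x by simp_all
  ultimately show "x \<in> Qbar"
    unfolding Qbar_def by blast
qed

theorem theorem2p1:
  fixes D :: "nat \<Rightarrow> nat"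
  assumes "finite {n. n \<ge> 1 \<and> D n \<noteq> 0}"
    and "uncountable (UNIV :: 'k::alg_closed_field set)"
  shows "(\<exists>h \<in> carrier (Bir (UNIV :: 'k set)). \<exists>d::int. d \<ge> 1 \<and>
            (\<forall>n::nat. n \<ge> 1 \<longrightarrow>
               int (ratmap_degree (h [^]\<^bsub>Bir (UNIV :: 'k set)\<^esub> n)) = d - int (D n))) \<and>
         (CHAR('k) = 0 \<longrightarrow>
           (\<exists>h \<in> carrier (Bir (Qbar :: 'k set)). \<exists>d::int. d \<ge> 1 \<and>
            (\<forall>n::nat. n \<ge> 1 \<longrightarrow>
               int (ratmap_degree (h [^]\<^bsub>Bir (Qbar :: 'k set)\<^esub> n)) = d - int (D n))))"
proof (intro conjI impI)
  obtain \<alpha> :: 'k and c :: "nat \<Rightarrow> 'k" where "inj (\<lambda>(j, k). c j * \<alpha> ^ k)"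
    using exists_disjoint_orbits_uncountable[OF assms(2)] by blast
  moreover have "subring_set (UNIV :: 'k set)"
    by (simp add: subring_set_def)
  ultimately show "\<exists>h \<in> carrier (Bir (UNIV :: 'k set)). \<exists>d::int. d \<ge> 1 \<and>
    (\<forall>n::nat. n \<ge> 1 \<longrightarrow> int (ratmap_degree (h [^]\<^bsub>Bir (UNIV :: 'k set)\<^esub> n)) = d - int (D n))"
    using assms(1) by (intro exists_Bir_with_degrees[where K = UNIV]) auto
next
  assume char: "CHAR('k) = 0"
  have two: "(2 :: 'k) \<noteq> 0"
    using of_nat_eq_0_iff_char_dvd[of 2, where 'a = 'k] char by simp
  have mem: "of_int m \<in> (int_fractions :: 'k set)" for m
    using int_fractionsI[of 1 m] by simp
  show "\<exists>h \<in> carrier (Bir (Qbar :: 'k set)). \<exists>d::int. d \<ge> 1 \<and>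
    (\<forall>n::nat. n \<ge> 1 \<longrightarrow> int (ratmap_degree (h [^]\<^bsub>Bir (Qbar :: 'k set)\<^esub> n)) = d - int (D n))"
  proof (rule exists_Bir_with_degrees[OF assms(1) disjoint_orbits_CHAR_0[OF char]
        subring_set_int_fractions int_fractions_subset_Qbar])
    show "2 \<in> (int_fractions :: 'k set)"
      using mem[of 2] by simp
    show "inverse 2 \<in> (int_fractions :: 'k set)"
      using int_fractionsI[of 2 1] two by (simp add: inverse_eq_divide)
    show "of_nat (2 * j + 1) \<in> (int_fractions :: 'k set)" for j
      using mem[of "int (2 * j + 1)"] by (simp only: of_int_of_nat_eq)
  qed
qed

end
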